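(* Let $s\ge 1$ be an integer, $\beta>0$ and $\lambda>0$. Let $\phi:\{\pm1\}\times\mathbb{R}\to\mathbb{R}_+$ be a $\lambda$-strongly proper composite binary loss with underlying (invertible) link function $\gamma$ on $[0,1]$, and let $\psi:\{0,1\}^s\times\mathbb{R}^{s^2+1}\to\mathbb{R}_+$ and $\mathrm{decode}:\mathbb{R}^{s^2+1}\to\{0,1\}^s$ be the surrogate loss and decoding map built from $(\phi,\gamma)$ as defined in the context. Then for all probability distributions $D$ on $\mathcal{X}\times\{0,1\}^s$ and all $\mathbf{f}:\mathcal{X}\to\mathbb{R}^{s^2+1}$, $$\mathrm{regret}_D^{F_\beta}[\mathrm{decode}\circ\mathbf{f}]\;\le\;\frac{1+\beta^2}{\beta}\sqrt{\frac{2(\ln s+1)}{\lambda}\cdot\mathrm{regret}_D^{\psi}[\mathbf{f}]}\,.$$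
   Context: $\mathcal{X}$ is an instance space (a measurable space); all functions are assumed measurable. $\mathbf{1}(\cdot)$ denotes the indicator, and for $\mathbf{y}\in\{0,1\}^s$, $\|\mathbf{y}\|_1=\sum_{j=1}^s y_j$. **$F_\beta$-measure and regret.** For $\mathbf{y},\hat{\mathbf{y}}\in\{0,1\}^s$, $$F_\beta(\mathbf{y},\hat{\mathbf{y}})=\frac{(1+\beta^2)\sum_{j=1}^s y_j\hat y_j}{\beta^2\|\mathbf{y}\|_1+\|\hat{\mathbf{y}}\|_1},$$ with the convention $\frac00=1$, so $F_\beta(\mathbf{0},\mathbf{0})=1$. For $\mathbf{h}:\mathcal{X}\to\{0,1\}^s$, $\mathrm{acc}_D^{F_\beta}[\mathbf{h}]=\mathbf{E}_{(x,\mathbf{y})\sim D}[F_\beta(\mathbf{y},\mathbf{h}(x))]$ and $$\mathrm{regret}_D^{F_\beta}[\mathbf{h}]=\sup_{\mathbf{h}':\mathcal{X}\to\{0,1\}^s}\mathrm{acc}_D^{F_\beta}[\mathbf{h}']-\mathrm{acc}_D^{F_\beta}[\mathbf{h}].$$ **Link functions and strongly proper composite losses.** A link function is an injective map $\gamma$ on $[0,1]$ whose inverse $\gamma^{-1}(u)\in[0,1]$ is defined for every $u\in\mathbb{R}$. The values of $\gamma$ are real, except that $\gamma(0),\gamma(1)$ may be infinite (as for the logit link $\gamma(p)=\ln\frac{p}{1-p}$). In that case $\phi(y,\pm\infty)\in[0,\infty]$ denotes the limit of $\phi(y,u)$ as $u\to\pm\infty$ (assumed to exist), with $0\cdot\infty=0$.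 For $q\in[0,1]$, $y\sim\mathrm{Bin}^{\pm1}(q)$ means $y=+1$ with probability $q$ and $y=-1$ with probability $1-q$. A binary loss $\phi:\{\pm1\}\times\mathbb{R}\to\mathbb{R}_+$ is $\lambda$-strongly proper composite with underlying link $\gamma$ if for all $q\in[0,1]$ and $u\in\mathbb{R}$, $$\mathbf{E}_{y\sim\mathrm{Bin}^{\pm1}(q)}\big[\phi(y,u)-\phi(y,\gamma(q))\big]\ge\frac{\lambda}{2}\big(\gamma^{-1}(u)-q\big)^2.$$ **Surrogate and decoding.** For $\mathbf{y},\hat{\mathbf{y}}\in\{0,1\}^s$ and $j,k\in\{1,\dots,s\}$ let $$a_{\mathbf{y},0}=\mathbf{1}(\|\mathbf{y}\|_1=0),\quad b_{\hat{\mathbf{y}},0}=-\mathbf{1}(\|\hat{\mathbf{y}}\|_1=0),\quad a_{\mathbf{y},jk}=\mathbf{1}(\|\mathbf{y}\|_1=k)\,y_j,\quad b_{\hat{\mathbf{y}},jk}=-\frac{(1+\beta^2)\hat y_j}{\beta^2k+\|\hat{\mathbf{y}}\|_1}.$$ Write $\mathbf{u}=(u_0,(u_{jk})_{j,k=1}^s)\in\mathbb{R}^{s^2+1}$. Define $$\psi(\mathbf{y},\mathbf{u})=a_{\mathbf{y},0}\phi(+1,u_0)+(1-a_{\mathbf{y},0})\phi(-1,u_0)+\sum_{j=1}^s\sum_{k=1}^s\Big(a_{\mathbf{y},jk}\phi(+1,u_{jk})+(1-a_{\mathbf{y},jk})\phi(-1,u_{jk})\Big),$$ $$\mathrm{decode}(\mathbf{u})\in\operatorname*{argmin}_{\hat{\mathbf{y}}\in\{0,1\}^s}\;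 b_{\hat{\mathbf{y}},0}\,\gamma^{-1}(u_0)+\sum_{j=1}^s\sum_{k=1}^s b_{\hat{\mathbf{y}},jk}\,\gamma^{-1}(u_{jk}),$$ with ties broken by any fixed (measurable) rule. **Surrogate regret.** $\mathrm{er}_D^\psi[\mathbf{f}]=\mathbf{E}_{(x,\mathbf{y})\sim D}[\psi(\mathbf{y},\mathbf{f}(x))]$ and $\mathrm{regret}_D^\psi[\mathbf{f}]=\mathrm{er}_D^\psi[\mathbf{f}]-\inf_{\mathbf{f}':\mathcal{X}\to\mathbb{R}^{s^2+1}}\mathrm{er}_D^\psi[\mathbf{f}']$ (equal to $+\infty$ if $\mathrm{er}_D^\psi[\mathbf{f}]=+\infty$). *)

theory Defs
  imports "HOL-Probability.Probability"
begin

text \<open>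
  A vector in \<open>{0,1}\<^sup>s\<close> is an extensional function on \<open>{1..s}\<close>.  A score vector
  in \<open>\<real>\<close> to the power \<open>s\<^sup>2 + 1\<close> is a pair of the component \<open>u\<^sub>0\<close> and the family
  \<open>u\<^sub>j\<^sub>k\<close>, an extensional function on \<open>{1..s} \<times> {1..s}\<close>.
\<close>

definition cube :: "nat \<Rightarrow> (nat \<Rightarrow> nat) set" where
  "cube s = {1..s} \<rightarrow>\<^sub>E {0, 1}"

definition l1 :: "nat \<Rightarrow> (nat \<Rightarrow> nat) \<Rightarrow> nat" where
  "l1 s y = (\<Sum>j = 1..s. y j)"

type_synonym score = "real \<times> (nat \<times> nat \<Rightarrow> real)"

definition score_space :: "nat \<Rightarrow> score measure" where
  "score_space s = borel \<Otimes>\<^sub>M (\<Pi>\<^sub>M jk \<in> {1..s} \<times> {1..s}. borel)"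


section \<open>The F-measure\<close>

text \<open>The first case is the convention \<open>0 / 0 = 1\<close>.\<close>

definition F_measure :: "nat \<Rightarrow> real \<Rightarrow> (nat \<Rightarrow> nat) \<Rightarrow> (nat \<Rightarrow> nat) \<Rightarrow> real" where
  "F_measure s \<beta> y y' =
     (let num = (1 + \<beta>\<^sup>2) * (\<Sum>j = 1..s. real (y j) * real (y' j));
          den = \<beta>\<^sup>2 * real (l1 s y) + real (l1 s y')
      in if num = 0 \<and> den = 0 then 1 else num / den)"

definition acc_F :: "nat \<Rightarrow> real \<Rightarrow> ('a \<times> (nat \<Rightarrow> nat)) measure \<Rightarrow> ('a \<Rightarrow> nat \<Rightarrow> nat) \<Rightarrow> real" where
  "acc_F s \<beta> D h = (\<integral>(x, y). F_measure s \<beta> y (h x) \<partial>D)"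

definition regret_F ::
  "'a measure \<Rightarrow> nat \<Rightarrow> real \<Rightarrow> ('a \<times> (nat \<Rightarrow> nat)) measure \<Rightarrow> ('a \<Rightarrow> nat \<Rightarrow> nat) \<Rightarrow> real" where
  "regret_F X s \<beta> D h =
     (SUP h' \<in> X \<rightarrow>\<^sub>M count_space (cube s). acc_F s \<beta> D h') - acc_F s \<beta> D h"


section \<open>Links and strongly proper composite losses\<close>

text \<open>Binary labels are the integers \<open>1\<close> and \<open>-1\<close>.\<close>

definition binary_loss :: "(int \<Rightarrow> real \<Rightarrow> real) \<Rightarrow> bool" where
  "binary_loss \<phi> \<longleftrightarrow>
     (\<forall>y \<in> {1, -1}. \<phi> y \<in> borel_measurable borel \<and> (\<forall>u. 0 \<le> \<phi> y u))"

definition link_function :: "(real \<Rightarrow> ereal) \<Rightarrow> bool" where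
  "link_function \<gamma> \<longleftrightarrow>
     \<gamma> \<in> borel_measurable (restrict_space borel {0..1}) \<and>
     inj_on \<gamma> {0..1} \<and>
     (\<forall>u :: real. ereal u \<in> \<gamma> ` {0..1}) \<and>
     (\<forall>p \<in> {0<..<1}. \<bar>\<gamma> p\<bar> \<noteq> \<infinity>)"

definition link_inv :: "(real \<Rightarrow> ereal) \<Rightarrow> real \<Rightarrow> real" where
  "link_inv \<gamma> u = the_inv_into {0..1} \<gamma> (ereal u)"

text \<open>The extension of a loss to infinite scores by limits in the extended reals.\<close>

definition loss_ext :: "(int \<Rightarrow> real \<Rightarrow> real) \<Rightarrow> int \<Rightarrow> ereal \<Rightarrow> ereal" where
  "loss_ext \<phi> y v =
     (if v = \<infinity> then Lim at_top (\<lambda>u. ereal (\<phi> y u))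
      else if v = -\<infinity> then Lim at_bot (\<lambda>u. ereal (\<phi> y u))
      else ereal (\<phi> y (real_of_ereal v)))"

definition loss_limits_exist :: "(int \<Rightarrow> real \<Rightarrow> real) \<Rightarrow> (real \<Rightarrow> ereal) \<Rightarrow> bool" where
  "loss_limits_exist \<phi> \<gamma> \<longleftrightarrow>
     (\<forall>y \<in> {1, -1}.
        (\<infinity> \<in> \<gamma> ` {0..1} \<longrightarrow> (\<exists>l. ((\<lambda>u. ereal (\<phi> y u)) \<longlongrightarrow> l) at_top)) \<and>
        (-\<infinity> \<in> \<gamma> ` {0..1} \<longrightarrow> (\<exists>l. ((\<lambda>u. ereal (\<phi> y u)) \<longlongrightarrow> l) at_bot)))"

text \<open>
  The expectation over the label is written out in the extended reals, where
  \<open>0 * (-\<infinity>) = 0\<close>; no difference \<open>\<infinity> - \<infinity>\<close> occurs, since \<open>\<phi> y u\<close> is finite.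
\<close>

definition strongly_proper_composite ::
  "real \<Rightarrow> (int \<Rightarrow> real \<Rightarrow> real) \<Rightarrow> (real \<Rightarrow> ereal) \<Rightarrow> bool" where
  "strongly_proper_composite \<kappa> \<phi> \<gamma> \<longleftrightarrow>
     loss_limits_exist \<phi> \<gamma> \<and>
     (\<forall>q \<in> {0..1}. \<forall>u :: real.
        ereal q * (ereal (\<phi> 1 u) - loss_ext \<phi> 1 (\<gamma> q)) +
        ereal (1 - q) * (ereal (\<phi> (-1) u) - loss_ext \<phi> (-1) (\<gamma> q))
        \<ge> ereal (\<kappa> / 2 * (link_inv \<gamma> u - q)\<^sup>2))"


section \<open>Surrogate loss and decoding\<close>

definition coef_a0 :: "nat \<Rightarrow> (nat \<Rightarrow> nat) \<Rightarrow> real" where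
  "coef_a0 s y = of_bool (l1 s y = 0)"

definition coef_b0 :: "nat \<Rightarrow> (nat \<Rightarrow> nat) \<Rightarrow> real" where
  "coef_b0 s y' = - of_bool (l1 s y' = 0)"

definition coef_a :: "nat \<Rightarrow> (nat \<Rightarrow> nat) \<Rightarrow> nat \<Rightarrow> nat \<Rightarrow> real" where
  "coef_a s y j k = of_bool (l1 s y = k) * real (y j)"

definition coef_b :: "nat \<Rightarrow> real \<Rightarrow> (nat \<Rightarrow> nat) \<Rightarrow> nat \<Rightarrow> nat \<Rightarrow> real" where
  "coef_b s \<beta> y' j k = - ((1 + \<beta>\<^sup>2) * real (y' j) / (\<beta>\<^sup>2 * real k + real (l1 s y')))"

definition surrogate :: "nat \<Rightarrow> (int \<Rightarrow> real \<Rightarrow> real) \<Rightarrow> (nat \<Rightarrow> nat) \<Rightarrow> score \<Rightarrow> real" where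
  "surrogate s \<phi> y u =
     coef_a0 s y * \<phi> 1 (fst u) + (1 - coef_a0 s y) * \<phi> (-1) (fst u) +
     (\<Sum>j = 1..s. \<Sum>k = 1..s.
        coef_a s y j k * \<phi> 1 (snd u (j, k)) + (1 - coef_a s y j k) * \<phi> (-1) (snd u (j, k)))"

definition decode_objective ::
  "nat \<Rightarrow> real \<Rightarrow> (real \<Rightarrow> ereal) \<Rightarrow> score \<Rightarrow> (nat \<Rightarrow> nat) \<Rightarrow> real" where
  "decode_objective s \<beta> \<gamma> u y' =
     coef_b0 s y' * link_inv \<gamma> (fst u) +
     (\<Sum>j = 1..s. \<Sum>k = 1..s. coef_b s \<beta> y' j k * link_inv \<gamma> (snd u (j, k)))"

text \<open>A decoding map is any measurable selection of minimizers, i.e. any tie-breaking rule.\<close>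

definition is_decode :: "nat \<Rightarrow> real \<Rightarrow> (real \<Rightarrow> ereal) \<Rightarrow> (score \<Rightarrow> nat \<Rightarrow> nat) \<Rightarrow> bool" where
  "is_decode s \<beta> \<gamma> decode \<longleftrightarrow>
     decode \<in> score_space s \<rightarrow>\<^sub>M count_space (cube s) \<and>
     (\<forall>u \<in> space (score_space s).
        is_arg_min (decode_objective s \<beta> \<gamma> u) (\<lambda>y'. y' \<in> cube s) (decode u))"

definition er_surrogate ::
  "nat \<Rightarrow> (int \<Rightarrow> real \<Rightarrow> real) \<Rightarrow> ('a \<times> (nat \<Rightarrow> nat)) measure \<Rightarrow> ('a \<Rightarrow> score) \<Rightarrow> ennreal" where
  "er_surrogate s \<phi> D f = (\<integral>\<^sup>+(x, y). ennreal (surrogate s \<phi> y (f x)) \<partial>D)"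

definition regret_surrogate ::
  "'a measure \<Rightarrow> nat \<Rightarrow> (int \<Rightarrow> real \<Rightarrow> real) \<Rightarrow> ('a \<times> (nat \<Rightarrow> nat)) measure \<Rightarrow>
   ('a \<Rightarrow> score) \<Rightarrow> ereal" where
  "regret_surrogate X s \<phi> D f =
     (if er_surrogate s \<phi> D f = \<infinity> then \<infinity>
      else enn2ereal (er_surrogate s \<phi> D f) -
           enn2ereal (INF f' \<in> X \<rightarrow>\<^sub>M score_space s. er_surrogate s \<phi> D f'))"

definition esqrt :: "ereal \<Rightarrow> ereal" where
  "esqrt x = (if x = \<infinity> then \<infinity> else ereal (sqrt (real_of_ereal x)))"

end

theory Submission
  imports Defs
begin

text \<open>
  Let \<open>q\<^sub>i(x)\<close> be the conditional expectation of \<open>a\<^sub>y\<^sub>,\<^sub>i\<close> given \<open>x\<close>.  Since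
  \<open>F\<^sub>\<beta>(y, v) = - \<Sum>\<^sub>i a\<^sub>y\<^sub>,\<^sub>i b\<^sub>v\<^sub>,\<^sub>i\<close>, the conditional accuracy of predicting \<open>v\<close> is
  \<open>- \<langle>b\<^sub>v, q(x)\<rangle>\<close>, and decoding maximises the same expression with \<open>q(x)\<close> replaced by the
  estimate \<open>\<gamma>\<^sup>-\<^sup>1(f(x))\<close>.  By the Cauchy-Schwarz inequality the conditional loss of accuracy is
  at most \<open>\<parallel>b\<^sub>v - b\<^sub>w\<parallel> \<parallel>\<gamma>\<^sup>-\<^sup>1(f(x)) - q(x)\<parallel>\<close>.  The inequality
  \<open>(\<beta>\<^sup>2 k + n)\<^sup>2 \<ge> 4 \<beta>\<^sup>2 k n\<close> turns \<open>\<parallel>b\<^sub>v\<parallel>\<^sup>2\<close> into a harmonic sum, strong properness bounds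
  the second norm by the conditional surrogate regret, and Jensen's inequality integrates the bound
  over \<open>x\<close>.

  The comparison function for the surrogate risk is a measurable, almost optimal real-valued
  score of \<open>q(x)\<close>.  The bound is integrated only after \<open>\<gamma>\<^sup>-\<^sup>1\<close> has been eliminated
  pointwise, so the measurability of \<open>\<gamma>\<^sup>-\<^sup>1\<close> plays no role.
\<close>

section \<open>Disintegration of a distribution over finitely many labels\<close>

text \<open>Restricting \<open>D\<close> to one label and projecting to \<open>X\<close> gives a
  measure that is absolutely continuous with respect to the marginal; its Radon-Nikodym derivative
  is the conditional probability of that label. There are finitely many labels, so one null set can
  be repaired to obtain nonnegativity and total mass 1 at every point.\<close>

lemma finite_disintegration:
  assumes "prob_space D" and sets_D: "sets D = sets (X \<Otimes>\<^sub>M count_space C)" and "finite C"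
  obtains p :: "'b \<Rightarrow> 'a \<Rightarrow> real" where
    "\<And>y. y \<in> C \<Longrightarrow> p y \<in> borel_measurable X"
    "\<And>y x. 0 \<le> p y x"
    "\<And>x. (\<Sum>y\<in>C. p y x) = 1"
    "\<And>g. (\<And>y. y \<in> C \<Longrightarrow> (\<lambda>x. g (x, y)) \<in> borel_measurable X) \<Longrightarrow>
      (\<integral>\<^sup>+z. g z \<partial>D) = (\<integral>\<^sup>+x. (\<Sum>y\<in>C. ennreal (p y x) * g (x, y)) \<partial>distr D X fst)"
proof -
  interpret D: prob_space D by fact
  have [measurable_cong]: "sets D = sets (X \<Otimes>\<^sub>M count_space C)" by fact
  have space_D: "space D = space X \<times> C"
    using sets_eq_imp_space_eq[OF sets_D] by (simp add: space_pair_measure)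
  have fst_meas [measurable]: "fst \<in> D \<rightarrow>\<^sub>M X" and snd_meas [measurable]: "snd \<in> D \<rightarrow>\<^sub>M count_space C"
    by measurable
  define M where "M = distr D X fst"
  interpret M: prob_space M unfolding M_def by (rule D.prob_space_distr) simp
  have sets_M [measurable_cong]: "sets M = sets X" and space_M: "space M = space X"
    by (simp_all add: M_def)
  \<comment> \<open>The part of \<open>D\<close> that carries the label \<open>y\<close>, seen as a
    measure on the instances.\<close>
  define N where "N y = distr (density D (\<lambda>z. indicator {y} (snd z))) X fst" for y :: 'b
  have ind [measurable]: "(\<lambda>z. indicator {y} (snd z) :: ennreal) \<in> borel_measurable D" for y :: 'b
    by (rule measurable_compose[OF snd_meas]) simp
  have sets_N: "sets (N y) = sets M" for y by (simp add: N_def M_def)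
  have N_int: "(\<integral>\<^sup>+x. h x \<partial>N y) = (\<integral>\<^sup>+z. indicator {y} (snd z) * h (fst z) \<partial>D)"
    if [measurable]: "h \<in> borel_measurable X" for h y
    unfolding N_def by (subst nn_integral_distr, simp_all) (subst nn_integral_density, simp_all)
  have ac: "absolutely_continuous M (N y)" for y
    unfolding absolutely_continuous_def
  proof
    fix A assume "A \<in> null_sets M"
    then have A [measurable]: "A \<in> sets X" and "emeasure M A = 0" by (auto simp: sets_M)
    then have "(\<integral>\<^sup>+z. indicator A (fst z) \<partial>D) = 0"
      by (simp add: M_def flip: nn_integral_distr[of fst D X "indicator A"])
    moreover have "emeasure (N y) A \<le> (\<integral>\<^sup>+z. indicator A (fst z) \<partial>D)"
    proof -
      have "emeasure (N y) A = (\<integral>\<^sup>+x. indicator A x \<partial>N y)"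
        using A by (simp add: sets_N sets_M)
      also have "\<dots> = (\<integral>\<^sup>+z. indicator {y} (snd z) * indicator A (fst z) \<partial>D)"
        by (rule N_int) simp
      also have "\<dots> \<le> (\<integral>\<^sup>+z. indicator A (fst z) \<partial>D)"
        by (intro nn_integral_mono) (auto split: split_indicator)
      finally show ?thesis .
    qed
    ultimately show "A \<in> null_sets (N y)" using A by (auto simp: sets_N sets_M)
  qed
  define r where "r y = RN_deriv M (N y)" for y
  have r_meas [measurable]: "r y \<in> borel_measurable X" for y
    using borel_measurable_RN_deriv[of M "N y"] by (simp add: r_def measurable_cong_sets[OF sets_M refl])
  have r: "density M (r y) = N y" for y
    unfolding r_def by (rule M.density_RN_deriv[OF ac sets_N])
  have int_r: "(\<integral>\<^sup>+z. g z \<partial>D) = (\<integral>\<^sup>+x. (\<Sum>y\<in>C. r y x * g (x, y)) \<partial>M)"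
    if g: "\<And>y. y \<in> C \<Longrightarrow> (\<lambda>x. g (x, y)) \<in> borel_measurable X" for g
  proof -
    \<comment> \<open>The product is cut into slices of constant label; exactly one indicator is
      nonzero at each point.\<close>
    have "(\<integral>\<^sup>+z. g z \<partial>D) = (\<integral>\<^sup>+z. (\<Sum>y\<in>C. indicator {y} (snd z) * g (fst z, y)) \<partial>D)"
    proof (intro nn_integral_cong)
      fix z assume z: "z \<in> space D"
      have "(\<Sum>y\<in>C. indicator {y} (snd z) * g (fst z, y)) =
            (\<Sum>y\<in>C. if y = snd z then g (fst z, y) else 0)"
        by (intro sum.cong) auto
      then show "g z = (\<Sum>y\<in>C. indicator {y} (snd z) * g (fst z, y))"
        using z \<open>finite C\<close> by (auto simp: space_D)
    qed
    also have "\<dots> = (\<Sum>y\<in>C. \<integral>\<^sup>+z. indicator {y} (snd z) * g (fst z, y) \<partial>D)"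
      using g by (intro nn_integral_sum borel_measurable_times_ennreal ind)
        (auto intro: measurable_compose[OF fst_meas])
    also have "\<dots> = (\<Sum>y\<in>C. \<integral>\<^sup>+x. g (x, y) \<partial>N y)"
      using g by (intro sum.cong) (auto simp: N_int)
    also have "\<dots> = (\<Sum>y\<in>C. \<integral>\<^sup>+x. r y x * g (x, y) \<partial>M)"
      using g by (intro sum.cong refl)
        (simp add: r[symmetric] nn_integral_density measurable_cong_sets[OF sets_M refl])
    also have "\<dots> = (\<integral>\<^sup>+x. (\<Sum>y\<in>C. r y x * g (x, y)) \<partial>M)"
      using g by (intro nn_integral_sum[symmetric])
        (simp add: measurable_cong_sets[OF sets_M refl])
    finally show ?thesis .
  qed
  \<comment> \<open>The slices add up to the marginal, so the sum of the derivatives and the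
    constant 1 are densities of the same measure.\<close>
  have r_sum: "AE x in M. (\<Sum>y\<in>C. r y x) = 1"
  proof (rule M.density_unique)
    show "density M (\<lambda>x. \<Sum>y\<in>C. r y x) = density M (\<lambda>_. 1)"
    proof (rule measure_eqI)
      fix A assume "A \<in> sets (density M (\<lambda>x. \<Sum>y\<in>C. r y x))"
      then have [measurable]: "A \<in> sets X" by (simp add: sets_M)
      have "(\<integral>\<^sup>+x. (\<Sum>y\<in>C. r y x * indicator A x) \<partial>M) = (\<integral>\<^sup>+z. indicator A (fst z) \<partial>D)"
        by (subst int_r) simp_all
      also have "\<dots> = emeasure M A"
        by (simp add: M_def flip: nn_integral_distr[of fst D X "indicator A"])
      finally show "emeasure (density M (\<lambda>x. \<Sum>y\<in>C. r y x)) A = emeasure (density M (\<lambda>_. 1)) A"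
        by (simp add: emeasure_density sum_distrib_right)
    qed simp
  qed measurable
  obtain c where c: "c \<in> C" using D.not_empty by (auto simp: space_D)
  \<comment> \<open>Where the derivatives fail to sum to 1, a null set, the conditional law is
    replaced by the point mass at the fixed label \<open>c\<close>.\<close>
  define p where "p y x = (if (\<Sum>y\<in>C. r y x) = 1 then if y \<in> C then enn2real (r y x) else 0
                           else of_bool (y = c))" for y x
  show ?thesis
  proof
    show "p y \<in> borel_measurable X" if "y \<in> C" for y
      unfolding p_def by measurable
    show "0 \<le> p y x" for y x by (simp add: p_def)
    have r_fin: "r y x \<noteq> \<top>" if "(\<Sum>y\<in>C. r y x) = 1" "y \<in> C" for x y
      using that \<open>finite C\<close> by (metis ennreal_one_neq_top sum.remove ennreal_add_eq_top)
    have p_r: "ennreal (p y x) = r y x" if "(\<Sum>y\<in>C. r y x) = 1" "y \<in> C" for x y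
      using that r_fin[OF that] by (simp add: p_def less_top)
    show "(\<Sum>y\<in>C. p y x) = 1" for x
    proof (cases "(\<Sum>y\<in>C. r y x) = 1")
      case True
      have "ennreal (\<Sum>y\<in>C. p y x) = (\<Sum>y\<in>C. ennreal (p y x))"
        by (rule sum_ennreal[symmetric]) (simp add: p_def)
      also have "\<dots> = 1" using True p_r[OF True] by simp
      finally show ?thesis by (simp add: ennreal_eq_1)
    next
      case False
      then show ?thesis using c \<open>finite C\<close> by (simp add: p_def of_bool_def)
    qed
    show "(\<integral>\<^sup>+z. g z \<partial>D) = (\<integral>\<^sup>+x. (\<Sum>y\<in>C. ennreal (p y x) * g (x, y)) \<partial>distr D X fst)"
      if g: "\<And>y. y \<in> C \<Longrightarrow> (\<lambda>x. g (x, y)) \<in> borel_measurable X" for g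
    proof -
      have "AE x in M. (\<Sum>y\<in>C. r y x * g (x, y)) = (\<Sum>y\<in>C. ennreal (p y x) * g (x, y))"
        using r_sum by eventually_elim (auto intro!: sum.cong simp: p_r)
      then show ?thesis
        unfolding M_def[symmetric] using trans[OF int_r[of g, OF g] nn_integral_cong_AE] by simp
    qed
  qed
qed

section \<open>Binary risk and nearly optimal real scores\<close>

text \<open>The weight \<open>q\<close> is a 0/1 coefficient when a single label vector is
  considered, and a conditional probability after averaging. One formula thus covers both the terms
  of the surrogate and their conditional expectations.\<close>

definition binary_risk :: "(int \<Rightarrow> real \<Rightarrow> real) \<Rightarrow> real \<Rightarrow> real \<Rightarrow> real" where
  "binary_risk \<phi> q u = q * \<phi> 1 u + (1 - q) * \<phi> (-1) u"

text \<open>Nonnegativity and the real bound \<open>B\<close> make the limit finite. Only then is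
  \<open>l\<close> strictly below \<open>l + ereal \<epsilon>\<close>, so that values of
  \<open>h\<close> eventually drop below the latter.\<close>

lemma tendsto_ereal_near:
  assumes lim: "((\<lambda>u. ereal (h u)) \<longlongrightarrow> l) F" and "F \<noteq> bot" and nonneg: "\<And>u. 0 \<le> h u"
    and le: "l \<le> ereal B" and "0 < \<epsilon>"
  obtains c where "ereal (h c) \<le> l + ereal \<epsilon>"
proof -
  have "0 \<le> l"
    by (rule tendsto_lowerbound[OF lim]) (use assms in auto)
  then have "l < l + ereal \<epsilon>" using le \<open>0 < \<epsilon>\<close> by (cases l) auto
  from order_tendstoD(2)[OF lim this] have "\<exists>c. ereal (h c) < l + ereal \<epsilon>"
    using eventually_happens' \<open>F \<noteq> bot\<close> by blast
  then show ?thesis using that less_imp_le by blast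
qed

text \<open>A real link value is its own witness. At an infinite one the extended loss is a limit of
  losses at real scores, and a score far enough out will do.\<close>

lemma loss_ext_near:
  assumes "binary_loss \<phi>" "loss_limits_exist \<phi> \<gamma>" "y \<in> {1, -1}" "q \<in> {0..1}"
    and le: "loss_ext \<phi> y (\<gamma> q) \<le> ereal B" and "0 < \<epsilon>"
  obtains c where "ereal (\<phi> y c) \<le> loss_ext \<phi> y (\<gamma> q) + ereal \<epsilon>"
proof (cases "\<gamma> q")
  case (real v)
  then show ?thesis using that[of v] \<open>0 < \<epsilon>\<close> by (simp add: loss_ext_def)
next
  case PInf
  with assms(4) have "\<infinity> \<in> \<gamma> ` {0..1}" by force
  with assms(2,3) obtain l where l: "((\<lambda>u. ereal (\<phi> y u)) \<longlongrightarrow> l) at_top"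
    unfolding loss_limits_exist_def by metis
  then have e: "loss_ext \<phi> y (\<gamma> q) = l"
    using PInf by (simp add: loss_ext_def tendsto_Lim)
  show ?thesis
    by (rule tendsto_ereal_near[OF l _ _ le[unfolded e] \<open>0 < \<epsilon>\<close>])
       (use assms(1,3) that e in \<open>auto simp: binary_loss_def\<close>)
next
  case MInf
  with assms(4) have "-\<infinity> \<in> \<gamma> ` {0..1}" by force
  with assms(2,3) obtain l where l: "((\<lambda>u. ereal (\<phi> y u)) \<longlongrightarrow> l) at_bot"
    unfolding loss_limits_exist_def by metis
  then have e: "loss_ext \<phi> y (\<gamma> q) = l"
    using MInf by (simp add: loss_ext_def tendsto_Lim)
  show ?thesis
    by (rule tendsto_ereal_near[OF l _ _ le[unfolded e] \<open>0 < \<epsilon>\<close>])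
       (use assms(1,3) that e in \<open>auto simp: binary_loss_def\<close>)
qed

text \<open>At \<open>q = 0\<close> and \<open>q = 1\<close> strong properness involves a single
  label, which is the form of the inequality for \<open>d\<close>. Replacing the extended loss by
  the loss at a nearby real score costs at most \<epsilon>.\<close>

lemma near_optimal_endpoint:
  assumes "binary_loss \<phi>" "loss_limits_exist \<phi> \<gamma>" "y \<in> {1, -1}" "q \<in> {0..1}" "0 < \<epsilon>"
    and sp: "\<And>u. ereal (d u) \<le> ereal (\<phi> y u) - loss_ext \<phi> y (\<gamma> q)"
    and d: "\<And>u. 0 \<le> d u"
  obtains c where "\<And>u. \<phi> y c + d u \<le> \<phi> y u + \<epsilon>"
proof -
  \<comment> \<open>Any single score shows that the extended loss is bounded by a real number; 0 is
    an arbitrary choice.\<close>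
  have "loss_ext \<phi> y (\<gamma> q) \<le> ereal (\<phi> y 0)"
    using sp[of 0] d[of 0] by (cases "loss_ext \<phi> y (\<gamma> q)") auto
  then obtain c where c: "ereal (\<phi> y c) \<le> loss_ext \<phi> y (\<gamma> q) + ereal \<epsilon>"
    using loss_ext_near[OF assms(1-4) _ assms(5)] by blast
  have "\<phi> y c + d u \<le> \<phi> y u + \<epsilon>" for u
    using c sp[of u] d[of u] by (cases "loss_ext \<phi> y (\<gamma> q)") auto
  then show ?thesis using that by blast
qed

text \<open>
  The link may be infinite at \<open>0\<close> and \<open>1\<close>, so the infimum of the binary risk need not be
  attained by a real score.  At these two points finite scores of almost optimal loss are used.
\<close>
lemma near_optimal_score:
  assumes bl: "binary_loss \<phi>" and link: "link_function \<gamma>"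
    and spc: "strongly_proper_composite \<kappa> \<phi> \<gamma>" and "0 < \<kappa>" "0 < \<epsilon>"
  obtains g where "g \<in> borel_measurable borel"
    "\<And>q u. q \<in> {0..1} \<Longrightarrow>
       binary_risk \<phi> q (g q) + \<kappa> / 2 * (link_inv \<gamma> u - q)\<^sup>2 \<le> binary_risk \<phi> q u + \<epsilon>"
proof -
  have lim: "loss_limits_exist \<phi> \<gamma>"
    and sp: "\<And>q u. q \<in> {0..1} \<Longrightarrow>
        ereal (\<kappa> / 2 * (link_inv \<gamma> u - q)\<^sup>2) \<le>
        ereal q * (ereal (\<phi> 1 u) - loss_ext \<phi> 1 (\<gamma> q)) +
        ereal (1 - q) * (ereal (\<phi> (-1) u) - loss_ext \<phi> (-1) (\<gamma> q))"
    using spc unfolding strongly_proper_composite_def by auto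
  \<comment> \<open>The term of the label 1 has weight 0 and vanishes even if its loss difference is
    infinite, since zero times infinity is 0 here.\<close>
  obtain c0 where c0: "\<And>u. \<phi> (-1) c0 + \<kappa> / 2 * (link_inv \<gamma> u - 0)\<^sup>2 \<le> \<phi> (-1) u + \<epsilon>"
    by (rule near_optimal_endpoint[OF bl lim, of "-1" 0 \<epsilon> "\<lambda>u. \<kappa> / 2 * (link_inv \<gamma> u - 0)\<^sup>2"])
       (use sp[of 0] \<open>0 < \<kappa>\<close> \<open>0 < \<epsilon>\<close> in \<open>auto simp: zero_ereal_def[symmetric] one_ereal_def[symmetric]\<close>)
  obtain c1 where c1: "\<And>u. \<phi> 1 c1 + \<kappa> / 2 * (link_inv \<gamma> u - 1)\<^sup>2 \<le> \<phi> 1 u + \<epsilon>"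
    by (rule near_optimal_endpoint[OF bl lim, of "1" 1 \<epsilon> "\<lambda>u. \<kappa> / 2 * (link_inv \<gamma> u - 1)\<^sup>2"])
       (use sp[of 1] \<open>0 < \<kappa>\<close> \<open>0 < \<epsilon>\<close> in \<open>auto simp: zero_ereal_def[symmetric] one_ereal_def[symmetric]\<close>)
  \<comment> \<open>Inside the open interval the link is finite and gives an exactly optimal score.
    The value 0 outside \<open>{0..1}\<close> only makes \<open>g\<close> a Borel function on the
    whole line.\<close>
  define g where "g q = (if q = 0 then c0 else if q = 1 then c1
                         else if q \<in> {0..1} then real_of_ereal (\<gamma> q) else 0)" for q
  show ?thesis
  proof
    have "(\<lambda>q. real_of_ereal (\<gamma> q)) \<in> borel_measurable (restrict_space borel {0..1})"
      using link unfolding link_function_def by (auto intro: borel_measurable_real_of_ereal)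
    then have "(\<lambda>q. if q \<in> {0..1} then real_of_ereal (\<gamma> q) else 0) \<in> borel_measurable borel"
      by (subst (asm) measurable_restrict_space_iff[where c = 0]) auto
    then show "g \<in> borel_measurable borel"
      unfolding g_def[abs_def] by measurable
    fix q u :: real assume q: "q \<in> {0..1}"
    consider "q = 0" | "q = 1" | "q \<in> {0<..<1}" using q by force
    then show "binary_risk \<phi> q (g q) + \<kappa> / 2 * (link_inv \<gamma> u - q)\<^sup>2 \<le> binary_risk \<phi> q u + \<epsilon>"
    proof cases
      case 3
      then have "\<bar>\<gamma> q\<bar> \<noteq> \<infinity>" using link unfolding link_function_def by simp
      then obtain v where v: "\<gamma> q = ereal v" by (cases "\<gamma> q") auto
      then have "g q = v" using 3 by (simp add: g_def)
      then show ?thesis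
        using sp[OF q, of u] v \<open>0 < \<epsilon>\<close> by (simp add: loss_ext_def binary_risk_def algebra_simps)
    qed (use c0[of u] c1[of u] in \<open>simp_all add: g_def binary_risk_def\<close>)
  qed
qed

section \<open>Jensen's inequality for the square root\<close>

text \<open>The concave square root lies below its tangent at \<open>r\<close>, and the tangent is
  affine in \<open>R x\<close>, so it can be integrated directly. The tangent exists because
  \<open>r\<close> is positive.\<close>

lemma (in prob_space) integral_le_sqrt:
  assumes "integrable M G" "integrable M R" and R: "\<And>x. x \<in> space M \<Longrightarrow> 0 \<le> R x"
    and G: "\<And>x. x \<in> space M \<Longrightarrow> G x \<le> K * sqrt (R x)"
    and "0 \<le> K" "0 < r" "(\<integral>x. R x \<partial>M) \<le> r"
  shows "(\<integral>x. G x \<partial>M) \<le> K * sqrt r"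
proof -
  have *: "G x \<le> K * ((R x / sqrt r + sqrt r) / 2)" if x: "x \<in> space M" for x
  proof -
    \<comment> \<open>This is the inequality of arithmetic and geometric means for
      \<open>R x\<close> and \<open>r\<close>.\<close>
    have "2 * sqrt (R x) * sqrt r \<le> R x + r"
      using sum_squares_bound[of "sqrt (R x)" "sqrt r"] R[OF x] \<open>0 < r\<close> by simp
    then have "sqrt (R x) \<le> (R x / sqrt r + sqrt r) / 2"
      using \<open>0 < r\<close> by (simp add: field_simps)
    then show ?thesis using G[OF x] mult_left_mono[OF _ \<open>0 \<le> K\<close>] order_trans by blast
  qed
  have "(\<integral>x. G x \<partial>M) \<le> (\<integral>x. K * ((R x / sqrt r + sqrt r) / 2) \<partial>M)"
    using assms(1,2) * by (intro integral_mono) auto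
  also have "\<dots> = K * (((\<integral>x. R x \<partial>M) / sqrt r + sqrt r) / 2)"
    using assms(2) by (simp add: prob_space)
  also have "\<dots> \<le> K * ((r / sqrt r + sqrt r) / 2)"
    using assms by (intro mult_left_mono divide_right_mono add_mono) auto
  also have "\<dots> = K * sqrt r" using \<open>0 < r\<close> by (simp add: real_div_sqrt)
  finally show ?thesis .
qed

section \<open>Score vectors and the norm of the decoding coefficients\<close>

text \<open>The index \<open>(0, 0)\<close> stands for the component \<open>u\<^sub>0\<close>, the index \<open>(j, k)\<close> for \<open>u\<^sub>j\<^sub>k\<close>.\<close>
definition score_idx :: "nat \<Rightarrow> (nat \<times> nat) set" where
  "score_idx s = insert (0, 0) ({1..s} \<times> {1..s})"

definition score_comp :: "score \<Rightarrow> nat \<times> nat \<Rightarrow> real" where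
  "score_comp u i = (if i = (0, 0) then fst u else snd u i)"

text \<open>Over the common index set, \<open>coef_A\<close> and \<open>coef_B\<close> are vectors
  whose inner product is minus the F-measure.\<close>

definition coef_A :: "nat \<Rightarrow> (nat \<Rightarrow> nat) \<Rightarrow> nat \<times> nat \<Rightarrow> real" where
  "coef_A s y i = (if i = (0, 0) then coef_a0 s y else coef_a s y (fst i) (snd i))"

definition coef_B :: "nat \<Rightarrow> real \<Rightarrow> (nat \<Rightarrow> nat) \<Rightarrow> nat \<times> nat \<Rightarrow> real" where
  "coef_B s \<beta> y' i = (if i = (0, 0) then coef_b0 s y' else coef_b s \<beta> y' (fst i) (snd i))"

lemma finite_score_idx [simp]: "finite (score_idx s)"
  by (simp add: score_idx_def)

lemma sum_score_idx:
  "(\<Sum>i\<in>score_idx s. h i) = h (0, 0) + (\<Sum>j = 1..s. \<Sum>k = 1..s. h (j, k))" for h :: "_ \<Rightarrow> real"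
  by (simp add: score_idx_def sum.cartesian_product)

lemma surrogate_altdef:
  "surrogate s \<phi> y u = (\<Sum>i\<in>score_idx s. binary_risk \<phi> (coef_A s y i) (score_comp u i))"
  by (simp add: surrogate_def sum_score_idx binary_risk_def coef_A_def score_comp_def)

lemma decode_objective_altdef:
  "decode_objective s \<beta> \<gamma> u y' =
     (\<Sum>i\<in>score_idx s. coef_B s \<beta> y' i * link_inv \<gamma> (score_comp u i))"
  by (simp add: decode_objective_def sum_score_idx coef_B_def score_comp_def)

lemma finite_cube: "finite (cube s)"
  unfolding cube_def by (intro finite_PiE) auto

lemma cube_le_1: "y \<in> cube s \<Longrightarrow> j \<in> {1..s} \<Longrightarrow> y j \<le> 1"
  unfolding cube_def by (drule PiE_mem) auto

lemma l1_le:
  assumes "y \<in> cube s" shows "l1 s y \<le> s"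
proof -
  have "l1 s y \<le> (\<Sum>j = 1..s. 1)"
    unfolding l1_def by (intro sum_mono) (use cube_le_1[OF assms] in auto)
  then show ?thesis by simp
qed

lemma coef_A_bounds:
  assumes "y \<in> cube s" "i \<in> score_idx s"
  shows "0 \<le> coef_A s y i" "coef_A s y i \<le> 1"
  using assms cube_le_1[OF assms(1), of "fst i"]
  by (auto simp: coef_A_def coef_a0_def coef_a_def score_idx_def)

text \<open>For nonzero \<open>y\<close> only the indices with \<open>k = l1 s y\<close> contribute,
  and there \<open>coef_b\<close> has exactly the denominator of the F-measure. For
  \<open>y = 0\<close> only the index \<open>(0, 0)\<close> contributes.\<close>

lemma F_measure_eq_sum:
  assumes "0 < \<beta>" "y \<in> cube s"
  shows "F_measure s \<beta> y y' = - (\<Sum>i\<in>score_idx s. coef_A s y i * coef_B s \<beta> y' i)"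
proof (cases "l1 s y = 0")
  \<comment> \<open>Here the numerator is 0, so the F-measure is 1 or 0 according to whether
    \<open>l1 s y'\<close> vanishes; the convention for 0/0 agrees with
    \<open>coef_b0\<close>.\<close>
  case True
  then have "y j = 0" if "j \<in> {1..s}" for j
    using that by (simp add: l1_def)
  then show ?thesis using True
    by (simp add: F_measure_def sum_score_idx coef_A_def coef_B_def coef_a0_def coef_b0_def coef_a_def Let_def)
next
  case False
  define m where "m = l1 s y"
  have m: "m \<in> {1..s}" using False l1_le[OF assms(2)] by (simp add: m_def)
  have den: "\<beta>\<^sup>2 * real m + real (l1 s y') > 0"
    using m \<open>0 < \<beta>\<close> by (intro add_pos_nonneg mult_pos_pos) auto
  have "(\<Sum>i\<in>score_idx s. coef_A s y i * coef_B s \<beta> y' i) =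
        (\<Sum>j = 1..s. \<Sum>k = 1..s. coef_a s y j k * coef_b s \<beta> y' j k)"
    using False by (simp add: sum_score_idx coef_A_def coef_B_def coef_a0_def)
  also have "\<dots> = (\<Sum>j = 1..s. \<Sum>k = 1..s. if m = k then real (y j) * coef_b s \<beta> y' j k else 0)"
    by (intro sum.cong) (auto simp: coef_a_def m_def)
  also have "\<dots> = (\<Sum>j = 1..s. real (y j) * coef_b s \<beta> y' j m)"
    using m by simp
  also have "\<dots> = - ((1 + \<beta>\<^sup>2) * (\<Sum>j = 1..s. real (y j) * real (y' j)) / (\<beta>\<^sup>2 * real m + real (l1 s y')))"
    by (simp add: coef_b_def sum_negf sum_distrib_left sum_divide_distrib algebra_simps)
  finally show ?thesis using den
    by (simp add: F_measure_def Let_def m_def)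
qed

lemma F_measure_nonneg: "0 \<le> F_measure s \<beta> y y'"
  by (auto simp: F_measure_def Let_def intro!: divide_nonneg_nonneg mult_nonneg_nonneg sum_nonneg)

text \<open>The harmonic number minus the logarithm is decreasing in \<open>s\<close> and equals 1
  at \<open>s = 1\<close>.\<close>

lemma sum_inverse_le_ln:
  assumes "1 \<le> s" shows "(\<Sum>k = 1..s. 1 / real k) \<le> ln (real s) + 1"
  using euler_mascheroni_sequence_decreasing[of 1 s] assms
  by (simp add: harm_def inverse_eq_divide)

text \<open>A nonzero entry of row \<open>j\<close> is at most a constant over \<open>n * k\<close>
  after squaring, where \<open>n\<close> is the number of ones of \<open>y'\<close>. Summing over
  the \<open>n\<close> nonzero rows cancels \<open>n\<close> and leaves the harmonic sum over
  \<open>k\<close>.\<close>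

lemma coef_B_norm:
  assumes "1 \<le> s" "0 < \<beta>" "y' \<in> cube s"
  shows "(\<Sum>i\<in>score_idx s. (coef_B s \<beta> y' i)\<^sup>2) \<le> ((1 + \<beta>\<^sup>2) / (2 * \<beta>))\<^sup>2 * (ln (real s) + 1)"
proof (cases "l1 s y' = 0")
  case True
  then have "y' j = 0" if "j \<in> {1..s}" for j
    using that by (simp add: l1_def)
  then have "(\<Sum>i\<in>score_idx s. (coef_B s \<beta> y' i)\<^sup>2) = 1"
    using True by (simp add: sum_score_idx coef_B_def coef_b0_def coef_b_def)
  \<comment> \<open>For \<open>y' = 0\<close> the norm is 1, which the constant dominates because
    \<open>2 * \<beta>\<close> is at most \<open>1 + \<beta>\<^sup>2\<close> and
    \<open>ln (real s)\<close> is nonnegative.\<close>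
  moreover have "1 \<le> (1 + \<beta>\<^sup>2) / (2 * \<beta>)"
    using sum_squares_bound[of 1 \<beta>] \<open>0 < \<beta>\<close> by simp
  then have "1 * 1 \<le> ((1 + \<beta>\<^sup>2) / (2 * \<beta>))\<^sup>2 * (ln (real s) + 1)"
    using \<open>1 \<le> s\<close> by (intro mult_mono) (auto simp: one_le_power)
  ultimately show ?thesis by simp
next
  case False
  define n where "n = l1 s y'"
  have n: "n > 0" using False by (simp add: n_def)
  let ?c = "((1 + \<beta>\<^sup>2) / (2 * \<beta>))\<^sup>2"
  have "(\<Sum>i\<in>score_idx s. (coef_B s \<beta> y' i)\<^sup>2) = (\<Sum>j = 1..s. \<Sum>k = 1..s. (coef_b s \<beta> y' j k)\<^sup>2)"
    using False by (simp add: sum_score_idx coef_B_def coef_b0_def)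
  also have "\<dots> \<le> (\<Sum>j = 1..s. \<Sum>k = 1..s. real (y' j) * (?c / n * (1 / real k)))"
  proof (intro sum_mono)
    fix j k assume j: "j \<in> {1..s}" and k: "k \<in> {1..s}"
    have y'_sq: "(real (y' j))\<^sup>2 = real (y' j)"
      using cube_le_1[OF assms(3) j] by (cases "y' j") auto
    have le: "((1 + \<beta>\<^sup>2) / (\<beta>\<^sup>2 * real k + real n))\<^sup>2 \<le> ?c / n * (1 / real k)"
    proof -
      have "4 * \<beta>\<^sup>2 * real n * real k \<le> (\<beta>\<^sup>2 * real k + real n)\<^sup>2"
        using zero_le_power2[of "\<beta>\<^sup>2 * real k - real n"] by (simp add: power2_eq_square algebra_simps)
      moreover have "0 < \<beta>\<^sup>2 * real k + real n"
        using n by (intro add_nonneg_pos) auto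
      ultimately have "(1 + \<beta>\<^sup>2)\<^sup>2 / (\<beta>\<^sup>2 * real k + real n)\<^sup>2 \<le> (1 + \<beta>\<^sup>2)\<^sup>2 / (4 * \<beta>\<^sup>2 * real n * real k)"
        using n k \<open>0 < \<beta>\<close> by (intro divide_left_mono mult_pos_pos) auto
      then show ?thesis by (simp add: power_divide power_mult_distrib mult_ac)
    qed
    have "(coef_b s \<beta> y' j k)\<^sup>2 = (real (y' j))\<^sup>2 * ((1 + \<beta>\<^sup>2) / (\<beta>\<^sup>2 * real k + real n))\<^sup>2"
      by (simp add: coef_b_def n_def power_mult_distrib power_divide)
    also have "\<dots> \<le> real (y' j) * (?c / n * (1 / real k))"
      unfolding y'_sq by (intro mult_left_mono le) simp
    finally show "(coef_b s \<beta> y' j k)\<^sup>2 \<le> real (y' j) * (?c / n * (1 / real k))" .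
  qed
  also have "\<dots> = (\<Sum>j = 1..s. real (y' j)) * (?c / n * (\<Sum>k = 1..s. 1 / real k))"
    unfolding sum_distrib_left[of "?c / n"] by (rule sum_product[symmetric])
  also have "\<dots> = ?c * (\<Sum>k = 1..s. 1 / real k)"
  proof -
    have "(\<Sum>j = 1..s. real (y' j)) = real n" by (simp add: n_def l1_def)
    then show ?thesis using n by simp
  qed
  also have "\<dots> \<le> ?c * (ln (real s) + 1)"
    by (intro mult_left_mono sum_inverse_le_ln assms) auto
  finally show ?thesis .
qed

lemma sum_diff_squares_le:
  fixes a b :: "'i \<Rightarrow> real"
  shows "(\<Sum>i\<in>I. (a i - b i)\<^sup>2) \<le> 2 * ((\<Sum>i\<in>I. (a i)\<^sup>2) + (\<Sum>i\<in>I. (b i)\<^sup>2))"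
  unfolding sum.distrib[symmetric] sum_distrib_left
proof (intro sum_mono)
  fix i show "(a i - b i)\<^sup>2 \<le> 2 * ((a i)\<^sup>2 + (b i)\<^sup>2)"
    using zero_le_power2[of "a i + b i"] by (simp add: power2_eq_square algebra_simps)
qed

lemma decode_gap_le:
  assumes "1 \<le> s" "0 < \<beta>" and "v \<in> cube s" "w \<in> cube s"
    and opt: "decode_objective s \<beta> \<gamma> u v \<le> decode_objective s \<beta> \<gamma> u w"
  shows "(\<Sum>i\<in>score_idx s. (coef_B s \<beta> v i - coef_B s \<beta> w i) * q i) \<le>
    (1 + \<beta>\<^sup>2) / \<beta> * sqrt ((ln (real s) + 1) *
      (\<Sum>i\<in>score_idx s. (link_inv \<gamma> (score_comp u i) - q i)\<^sup>2))"
proof -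
  let ?I = "score_idx s" and ?d = "\<lambda>i. coef_B s \<beta> v i - coef_B s \<beta> w i"
    and ?e = "\<lambda>i. q i - link_inv \<gamma> (score_comp u i)"
  have "(\<Sum>i\<in>?I. (?d i)\<^sup>2) \<le> 2 * ((\<Sum>i\<in>?I. (coef_B s \<beta> v i)\<^sup>2) + (\<Sum>i\<in>?I. (coef_B s \<beta> w i)\<^sup>2))"
    by (rule sum_diff_squares_le)
  \<comment> \<open>Two norms and the factor 2 give the factor 4, which cancels the 2 in
    \<open>2 * \<beta>\<close>.\<close>
  also have "\<dots> \<le> 4 * (((1 + \<beta>\<^sup>2) / (2 * \<beta>))\<^sup>2 * (ln (real s) + 1))"
    using coef_B_norm[OF assms(1,2,3)] coef_B_norm[OF assms(1,2,4)] by simp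
  also have "\<dots> = ((1 + \<beta>\<^sup>2) / \<beta>)\<^sup>2 * (ln (real s) + 1)"
    by (simp add: power_divide power_mult_distrib)
  finally have d: "(\<Sum>i\<in>?I. (?d i)\<^sup>2) \<le> ((1 + \<beta>\<^sup>2) / \<beta>)\<^sup>2 * (ln (real s) + 1)" .
  \<comment> \<open>Since \<open>v\<close> does at least as well as \<open>w\<close> on the
    estimated probabilities, the inner product of \<open>?d\<close> with the estimate is at most 0.
    Subtracting it replaces \<open>q\<close> by the estimation error.\<close>
  have "(\<Sum>i\<in>?I. ?d i * q i) \<le> (\<Sum>i\<in>?I. ?d i * ?e i)"
    using opt by (simp add: decode_objective_altdef sum_subtractf sum.distrib algebra_simps)
  also have "\<dots> \<le> sqrt ((\<Sum>i\<in>?I. (?d i)\<^sup>2) * (\<Sum>i\<in>?I. (?e i)\<^sup>2))"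
    by (intro real_le_rsqrt Cauchy_Schwarz_ineq_sum)
  also have "\<dots> \<le> sqrt (((1 + \<beta>\<^sup>2) / \<beta>)\<^sup>2 * (ln (real s) + 1) * (\<Sum>i\<in>?I. (?e i)\<^sup>2))"
    by (intro real_sqrt_le_mono mult_right_mono d sum_nonneg) auto
  also have "\<dots> = (1 + \<beta>\<^sup>2) / \<beta> * sqrt ((ln (real s) + 1) * (\<Sum>i\<in>?I. (?e i)\<^sup>2))"
    using \<open>0 < \<beta>\<close> by (simp add: real_sqrt_mult mult.assoc)
  finally show ?thesis by (simp add: power2_commute)
qed

section \<open>Averages of the binary risk and measurability of scores\<close>

lemma binary_risk_nonneg:
  assumes "binary_loss \<phi>" "q \<in> {0..1}" shows "0 \<le> binary_risk \<phi> q u"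
  using assms by (auto simp: binary_risk_def binary_loss_def intro!: add_nonneg_nonneg mult_nonneg_nonneg)

text \<open>The risk is affine in its first argument, so it commutes with averages of total weight
  1.\<close>

lemma binary_risk_mixture:
  assumes "(\<Sum>y\<in>C. p y) = 1"
  shows "(\<Sum>y\<in>C. p y * binary_risk \<phi> (a y) u) = binary_risk \<phi> (\<Sum>y\<in>C. p y * a y) u"
proof -
  have "(\<Sum>y\<in>C. p y * binary_risk \<phi> (a y) u) =
        (\<Sum>y\<in>C. p y * a y) * \<phi> 1 u + ((\<Sum>y\<in>C. p y) - (\<Sum>y\<in>C. p y * a y)) * \<phi> (-1) u"
    by (simp add: binary_risk_def sum.distrib sum_subtractf sum_distrib_left sum_distrib_right algebra_simps)
  then show ?thesis using assms by (simp add: binary_risk_def)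
qed

lemma measurable_binary_risk [measurable (raw)]:
  assumes "binary_loss \<phi>" "q \<in> borel_measurable M" "u \<in> borel_measurable M"
  shows "(\<lambda>x. binary_risk \<phi> (q x) (u x)) \<in> borel_measurable M"
proof -
  have [measurable]: "\<phi> 1 \<in> borel_measurable borel" "\<phi> (-1) \<in> borel_measurable borel"
    using assms(1) by (auto simp: binary_loss_def)
  show ?thesis using assms(2,3) unfolding binary_risk_def by measurable
qed

lemma measurable_score_comp:
  assumes "i \<in> score_idx s"
  shows "(\<lambda>u. score_comp u i) \<in> borel_measurable (score_space s)"
proof (cases "i = (0, 0)")
  case True
  then show ?thesis by (simp add: score_comp_def score_space_def)
next
  case False
  with assms have "i \<in> {1..s} \<times> {1..s}" by (simp add: score_idx_def)
  with False show ?thesis unfolding score_comp_def score_space_def by simp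
qed

text \<open>This assembles the comparison score from its components, each a measurable function of
  the instance.\<close>

lemma ex_measurable_score:
  assumes v: "\<And>i. i \<in> score_idx s \<Longrightarrow> (\<lambda>x. v x i) \<in> borel_measurable X"
  obtains f where "f \<in> X \<rightarrow>\<^sub>M score_space s"
    "\<And>x i. i \<in> score_idx s \<Longrightarrow> score_comp (f x) i = v x i"
proof
  let ?f = "\<lambda>x. (v x (0, 0), \<lambda>i\<in>{1..s} \<times> {1..s}. v x i)"
  show "?f \<in> X \<rightarrow>\<^sub>M score_space s"
    unfolding score_space_def
    by (intro measurable_Pair measurable_restrict v) (auto simp: score_idx_def)
  show "score_comp (?f x) i = v x i" if "i \<in> score_idx s" for x i
    using that by (auto simp: score_comp_def score_idx_def)
qed

text \<open>The second coordinate takes countably many values, so joint measurability can be checked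
  with that value held fixed.\<close>

lemma measurable_pair_count_space:
  assumes "countable C" and f: "\<And>y. y \<in> C \<Longrightarrow> (\<lambda>x. f (x, y)) \<in> M \<rightarrow>\<^sub>M N"
  shows "f \<in> M \<Otimes>\<^sub>M count_space C \<rightarrow>\<^sub>M N"
proof -
  have "(\<lambda>z. f (fst z, snd z)) \<in> M \<Otimes>\<^sub>M count_space C \<rightarrow>\<^sub>M N"
    by (rule measurable_compose_countable'[where f = "\<lambda>y z. f (fst z, y)" and g = snd,
          OF measurable_compose[OF measurable_fst f] measurable_snd \<open>countable C\<close>])
  then show ?thesis by simp
qed

section \<open>Conditional risk and conditional accuracy given the instance\<close>

text \<open>One version \<open>p\<close> of the conditional label probabilities is fixed once, so
  that all conditional quantities are defined at every instance and not only almost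
  everywhere.\<close>

locale cube_disintegration =
  fixes X :: "'a measure" and s :: nat and D :: "('a \<times> (nat \<Rightarrow> nat)) measure"
    and p :: "(nat \<Rightarrow> nat) \<Rightarrow> 'a \<Rightarrow> real"
  assumes prob_D: "prob_space D"
    and sets_D: "sets D = sets (X \<Otimes>\<^sub>M count_space (cube s))"
    and p_measurable: "\<And>y. y \<in> cube s \<Longrightarrow> p y \<in> borel_measurable X"
    and p_nonneg: "\<And>y x. 0 \<le> p y x"
    and p_sum: "\<And>x. (\<Sum>y\<in>cube s. p y x) = 1"
    and nn_integral_p: "\<And>g. (\<And>y. y \<in> cube s \<Longrightarrow> (\<lambda>x. g (x, y)) \<in> borel_measurable X) \<Longrightarrow>
      (\<integral>\<^sup>+z. g z \<partial>D) = (\<integral>\<^sup>+x. (\<Sum>y\<in>cube s. ennreal (p y x) * g (x, y)) \<partial>distr D X fst)"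
begin

abbreviation "M \<equiv> distr D X fst"

sublocale M: prob_space M
  using prob_D by (rule prob_space.prob_space_distr) (simp add: measurable_cong_sets[OF sets_D refl])

text \<open>At \<open>(0, 0)\<close> this is the conditional probability of the zero label vector;
  at \<open>(j, k)\<close> it is that of a label vector with \<open>k\<close> ones, one of them at
  position \<open>j\<close>.\<close>

definition q :: "'a \<Rightarrow> nat \<times> nat \<Rightarrow> real" where
  "q x i = (\<Sum>y\<in>cube s. p y x * coef_A s y i)"

definition cond_risk :: "(int \<Rightarrow> real \<Rightarrow> real) \<Rightarrow> 'a \<Rightarrow> score \<Rightarrow> real" where
  "cond_risk \<phi> x u = (\<Sum>i\<in>score_idx s. binary_risk \<phi> (q x i) (score_comp u i))"

text \<open>For positive \<beta> this is the conditional expectation of the F-measure when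
  \<open>v\<close> is predicted. In this form it is minus the decoding objective with the estimates
  replaced by the true \<open>q x i\<close>.\<close>

definition cond_acc :: "real \<Rightarrow> 'a \<Rightarrow> (nat \<Rightarrow> nat) \<Rightarrow> real" where
  "cond_acc \<beta> x v = - (\<Sum>i\<in>score_idx s. coef_B s \<beta> v i * q x i)"

lemma q_measurable: "(\<lambda>x. q x i) \<in> borel_measurable X"
  unfolding q_def by (intro borel_measurable_sum borel_measurable_times p_measurable) auto

lemma q_range:
  assumes "i \<in> score_idx s" shows "q x i \<in> {0..1}"
proof -
  have "q x i \<le> (\<Sum>y\<in>cube s. p y x * 1)"
    unfolding q_def using assms by (intro sum_mono mult_left_mono coef_A_bounds p_nonneg)
  moreover have "0 \<le> q x i"
    unfolding q_def using assms by (intro sum_nonneg mult_nonneg_nonneg coef_A_bounds p_nonneg)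
  ultimately show ?thesis using p_sum by simp
qed

lemma sum_p_F:
  assumes "0 < \<beta>"
  shows "(\<Sum>y\<in>cube s. p y x * F_measure s \<beta> y v) = cond_acc \<beta> x v"
proof -
  have "(\<Sum>y\<in>cube s. p y x * F_measure s \<beta> y v) =
        - (\<Sum>y\<in>cube s. \<Sum>i\<in>score_idx s. p y x * (coef_A s y i * coef_B s \<beta> v i))"
    using assms by (simp add: F_measure_eq_sum sum_distrib_left sum_negf)
  also have "\<dots> = - (\<Sum>i\<in>score_idx s. \<Sum>y\<in>cube s. p y x * (coef_A s y i * coef_B s \<beta> v i))"
    by (subst sum.swap) (rule refl)
  also have "\<dots> = cond_acc \<beta> x v"
    by (simp add: cond_acc_def q_def sum_distrib_left mult_ac)
  finally show ?thesis .
qed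

lemma cond_acc_nonneg: "0 < \<beta> \<Longrightarrow> 0 \<le> cond_acc \<beta> x v"
  unfolding sum_p_F[symmetric] by (intro sum_nonneg mult_nonneg_nonneg p_nonneg F_measure_nonneg)

lemma sum_p_surrogate: "(\<Sum>y\<in>cube s. p y x * surrogate s \<phi> y u) = cond_risk \<phi> x u"
proof -
  have "(\<Sum>y\<in>cube s. p y x * surrogate s \<phi> y u) =
        (\<Sum>i\<in>score_idx s. \<Sum>y\<in>cube s. p y x * binary_risk \<phi> (coef_A s y i) (score_comp u i))"
    unfolding surrogate_altdef sum_distrib_left by (rule sum.swap)
  also have "\<dots> = cond_risk \<phi> x u"
    by (simp add: cond_risk_def q_def binary_risk_mixture[OF p_sum])
  finally show ?thesis .
qed

lemma cond_risk_nonneg: "binary_loss \<phi> \<Longrightarrow> 0 \<le> cond_risk \<phi> x u"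
  unfolding cond_risk_def by (intro sum_nonneg binary_risk_nonneg q_range)

lemma measurable_score_comp_comp:
  "f \<in> X \<rightarrow>\<^sub>M score_space s \<Longrightarrow> i \<in> score_idx s \<Longrightarrow> (\<lambda>x. score_comp (f x) i) \<in> borel_measurable X"
  by (rule measurable_compose[OF _ measurable_score_comp])

lemma cond_risk_measurable:
  assumes "binary_loss \<phi>" "f \<in> X \<rightarrow>\<^sub>M score_space s"
  shows "(\<lambda>x. cond_risk \<phi> x (f x)) \<in> borel_measurable X"
  unfolding cond_risk_def
  by (intro borel_measurable_sum measurable_binary_risk measurable_score_comp_comp q_measurable assms)

text \<open>The label is integrated out first. All terms are nonnegative, so the computation is
  valid for infinite risk as well.\<close>

lemma er_surrogate_eq:
  assumes \<phi>: "binary_loss \<phi>" and f: "f \<in> X \<rightarrow>\<^sub>M score_space s"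
  shows "er_surrogate s \<phi> D f = (\<integral>\<^sup>+x. ennreal (cond_risk \<phi> x (f x)) \<partial>M)"
proof -
  have surr: "0 \<le> surrogate s \<phi> y (f x)" if "y \<in> cube s" for x y
    unfolding surrogate_altdef using that \<phi>
    by (intro sum_nonneg binary_risk_nonneg) (auto simp: coef_A_bounds)
  have "(\<lambda>x. surrogate s \<phi> y (f x)) \<in> borel_measurable X" for y
    unfolding surrogate_altdef
    by (intro borel_measurable_sum measurable_binary_risk \<phi> measurable_score_comp_comp[OF f]) auto
  then have "er_surrogate s \<phi> D f =
      (\<integral>\<^sup>+x. (\<Sum>y\<in>cube s. ennreal (p y x) * ennreal (surrogate s \<phi> y (f x))) \<partial>M)"
    unfolding er_surrogate_def by (subst nn_integral_p) auto
  also have "\<dots> = (\<integral>\<^sup>+x. ennreal (\<Sum>y\<in>cube s. p y x * surrogate s \<phi> y (f x)) \<partial>M)"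
  proof (intro nn_integral_cong)
    fix x
    have "(\<Sum>y\<in>cube s. ennreal (p y x) * ennreal (surrogate s \<phi> y (f x))) =
        (\<Sum>y\<in>cube s. ennreal (p y x * surrogate s \<phi> y (f x)))"
      by (simp add: ennreal_mult p_nonneg surr)
    also have "\<dots> = ennreal (\<Sum>y\<in>cube s. p y x * surrogate s \<phi> y (f x))"
      by (rule sum_ennreal) (simp add: p_nonneg surr)
    finally show "(\<Sum>y\<in>cube s. ennreal (p y x) * ennreal (surrogate s \<phi> y (f x))) =
        ennreal (\<Sum>y\<in>cube s. p y x * surrogate s \<phi> y (f x))" .
  qed
  finally show ?thesis by (simp add: sum_p_surrogate)
qed

text \<open>Finite risks become real integrals, which can be subtracted from each other.\<close>

lemma
  assumes \<phi>: "binary_loss \<phi>" and f: "f \<in> X \<rightarrow>\<^sub>M score_space s"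
    and fin: "er_surrogate s \<phi> D f \<noteq> \<infinity>"
  shows integrable_cond_risk: "integrable M (\<lambda>x. cond_risk \<phi> x (f x))"
    and integral_cond_risk:
      "ennreal (\<integral>x. cond_risk \<phi> x (f x) \<partial>M) = er_surrogate s \<phi> D f"
proof -
  show *: "integrable M (\<lambda>x. cond_risk \<phi> x (f x))"
    using fin cond_risk_measurable[OF \<phi> f] cond_risk_nonneg[OF \<phi>]
    by (intro integrableI_nonneg) (auto simp: er_surrogate_eq[OF \<phi> f] less_top)
  show "ennreal (\<integral>x. cond_risk \<phi> x (f x) \<partial>M) = er_surrogate s \<phi> D f"
    using nn_integral_eq_integral[OF *] cond_risk_nonneg[OF \<phi>] by (simp add: er_surrogate_eq[OF \<phi> f])
qed

lemma measurable_cube_fun: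
  "h \<in> X \<rightarrow>\<^sub>M count_space (cube s) \<Longrightarrow> (\<lambda>x. c (h x)) \<in> borel_measurable X"
  by (rule measurable_compose[where N = "count_space (cube s)"]) simp_all

lemma cond_acc_measurable:
  assumes "h \<in> X \<rightarrow>\<^sub>M count_space (cube s)"
  shows "(\<lambda>x. cond_acc \<beta> x (h x)) \<in> borel_measurable X"
  unfolding cond_acc_def
  by (intro borel_measurable_uminus borel_measurable_sum borel_measurable_times q_measurable
      measurable_cube_fun[OF assms])

text \<open>There are finitely many predictions and \<open>q\<close> takes values in
  \<open>{0..1}\<close>, so the integrand is bounded.\<close>

lemma cond_acc_integrable:
  assumes h: "h \<in> X \<rightarrow>\<^sub>M count_space (cube s)"
  shows "integrable M (\<lambda>x. cond_acc \<beta> x (h x))"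
proof (rule M.integrable_const_bound)
  let ?c = "\<lambda>v. \<Sum>i\<in>score_idx s. \<bar>coef_B s \<beta> v i\<bar>"
  show "AE x in M. norm (cond_acc \<beta> x (h x)) \<le> (\<Sum>v\<in>cube s. ?c v)"
  proof (rule AE_I2)
    fix x assume "x \<in> space M"
    then have hx: "h x \<in> cube s" using measurable_space[OF h] by simp
    have "norm (cond_acc \<beta> x (h x)) \<le> (\<Sum>i\<in>score_idx s. \<bar>coef_B s \<beta> (h x) i * q x i\<bar>)"
      by (simp add: cond_acc_def sum_abs)
    also have "\<dots> \<le> ?c (h x)"
      using q_range by (intro sum_mono) (auto simp: abs_mult intro!: mult_left_le)
    also have "\<dots> \<le> (\<Sum>v\<in>cube s. ?c v)"
      using hx finite_cube by (intro member_le_sum) (auto intro!: sum_nonneg)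
    finally show "norm (cond_acc \<beta> x (h x)) \<le> (\<Sum>v\<in>cube s. ?c v)" .
  qed
qed (use cond_acc_measurable[OF h] in simp)

text \<open>The disintegration is stated for nonnegative integrals; the F-measure is nonnegative, so
  the accuracy can be converted to such an integral and back.\<close>

lemma acc_F_eq:
  assumes h: "h \<in> X \<rightarrow>\<^sub>M count_space (cube s)" and "0 < \<beta>"
  shows "acc_F s \<beta> D h = (\<integral>x. cond_acc \<beta> x (h x) \<partial>M)"
proof -
  have F [measurable]: "(\<lambda>x. F_measure s \<beta> y (h x)) \<in> borel_measurable X" for y
    by (rule measurable_cube_fun[OF h])
  have "(\<lambda>(x, y). F_measure s \<beta> y (h x)) \<in> borel_measurable D"
    unfolding measurable_cong_sets[OF sets_D refl]
    by (rule measurable_pair_count_space) (auto simp: finite_cube countable_finite)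
  then have "acc_F s \<beta> D h = enn2real (\<integral>\<^sup>+z. ennreal (case z of (x, y) \<Rightarrow> F_measure s \<beta> y (h x)) \<partial>D)"
    unfolding acc_F_def by (intro integral_eq_nn_integral) (auto simp: F_measure_nonneg)
  also have "(\<integral>\<^sup>+z. ennreal (case z of (x, y) \<Rightarrow> F_measure s \<beta> y (h x)) \<partial>D) =
      (\<integral>\<^sup>+x. (\<Sum>y\<in>cube s. ennreal (p y x) * ennreal (F_measure s \<beta> y (h x))) \<partial>M)"
    by (subst nn_integral_p) auto
  also have "\<dots> = (\<integral>\<^sup>+x. ennreal (cond_acc \<beta> x (h x)) \<partial>M)"
  proof (intro nn_integral_cong)
    fix x
    have "(\<Sum>y\<in>cube s. ennreal (p y x) * ennreal (F_measure s \<beta> y (h x))) =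
        (\<Sum>y\<in>cube s. ennreal (p y x * F_measure s \<beta> y (h x)))"
      by (simp add: ennreal_mult p_nonneg F_measure_nonneg)
    also have "\<dots> = ennreal (\<Sum>y\<in>cube s. p y x * F_measure s \<beta> y (h x))"
      by (rule sum_ennreal) (simp add: p_nonneg F_measure_nonneg)
    finally show "(\<Sum>y\<in>cube s. ennreal (p y x) * ennreal (F_measure s \<beta> y (h x))) =
        ennreal (cond_acc \<beta> x (h x))"
      unfolding sum_p_F[OF \<open>0 < \<beta>\<close>] .
  qed
  also have "enn2real \<dots> = (\<integral>x. cond_acc \<beta> x (h x) \<partial>M)"
    using cond_acc_measurable[OF h] cond_acc_nonneg[OF \<open>0 < \<beta>\<close>]
    by (intro integral_eq_nn_integral[symmetric]) auto
  finally show ?thesis .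
qed

section \<open>Accuracy gap against surrogate excess risk\<close>

text \<open>An optimal real score may not exist, so \<open>f\<close> is compared with a nearly
  optimal \<open>f'\<close>, at the price of the slack \<epsilon>. At each instance strong
  properness bounds the squared estimation error by the conditional excess risk,
  \<open>decode_gap_le\<close> bounds the accuracy gap by the root of that error, and the tangent
  bound integrates the result.\<close>

lemma acc_gap_le_er_gap:
  assumes "1 \<le> s" "0 < \<beta>" "0 < \<kappa>" and \<phi>: "binary_loss \<phi>" and link: "link_function \<gamma>"
    and spc: "strongly_proper_composite \<kappa> \<phi> \<gamma>"
    and f: "f \<in> X \<rightarrow>\<^sub>M score_space s" and fin: "er_surrogate s \<phi> D f \<noteq> \<infinity>"
    and h: "h \<in> X \<rightarrow>\<^sub>M count_space (cube s)" and h': "h' \<in> X \<rightarrow>\<^sub>M count_space (cube s)"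
    and opt: "\<And>x. x \<in> space X \<Longrightarrow>
      decode_objective s \<beta> \<gamma> (f x) (h x) \<le> decode_objective s \<beta> \<gamma> (f x) (h' x)"
    and "0 < \<epsilon>"
  obtains f' where "f' \<in> X \<rightarrow>\<^sub>M score_space s" "er_surrogate s \<phi> D f' \<noteq> \<infinity>"
    "acc_F s \<beta> D h' - acc_F s \<beta> D h \<le> (1 + \<beta>\<^sup>2) / \<beta> * sqrt (2 * (ln (real s) + 1) / \<kappa>) *
       sqrt (enn2real (er_surrogate s \<phi> D f) - enn2real (er_surrogate s \<phi> D f') + \<epsilon>)"
proof -
  define n where "n = real (card (score_idx s))"
  have n: "0 < n"
  proof -
    have "score_idx s \<noteq> {}" by (simp add: score_idx_def)
    then show ?thesis by (simp add: n_def card_gt_0_iff)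
  qed
  \<comment> \<open>The errors of the \<open>n\<close> components add up to half of \<epsilon>; the
    other half makes \<open>r\<close> below strictly positive.\<close>
  define \<delta> where "\<delta> = \<epsilon> / (2 * n)"
  have \<delta>: "0 < \<delta>" "n * \<delta> < \<epsilon>" using n \<open>0 < \<epsilon>\<close> by (simp_all add: \<delta>_def)
  obtain g where g: "g \<in> borel_measurable borel"
    and g_opt: "\<And>q u. q \<in> {0..1} \<Longrightarrow>
       binary_risk \<phi> q (g q) + \<kappa> / 2 * (link_inv \<gamma> u - q)\<^sup>2 \<le> binary_risk \<phi> q u + \<delta>"
    using near_optimal_score[OF \<phi> link spc \<open>0 < \<kappa>\<close> \<delta>(1)] by blast
  obtain f' where f': "f' \<in> X \<rightarrow>\<^sub>M score_space s"
    and f'_comp: "\<And>x i. i \<in> score_idx s \<Longrightarrow> score_comp (f' x) i = g (q x i)"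
    using ex_measurable_score[of s "\<lambda>x i. g (q x i)" X] measurable_compose[OF q_measurable g] by blast
  define d where "d x = (\<Sum>i\<in>score_idx s. (link_inv \<gamma> (score_comp (f x) i) - q x i)\<^sup>2)" for x
  \<comment> \<open>The conditional excess risk of \<open>f\<close> over \<open>f'\<close>, shifted
    by the total error of \<open>f'\<close> so that it is nonnegative.\<close>
  define R where "R x = cond_risk \<phi> x (f x) - cond_risk \<phi> x (f' x) + n * \<delta>" for x
  have d_nonneg: "0 \<le> d x" for x by (simp add: d_def sum_nonneg)
  have d_le: "\<kappa> / 2 * d x \<le> R x" for x
  proof -
    have "cond_risk \<phi> x (f' x) + \<kappa> / 2 * d x =
        (\<Sum>i\<in>score_idx s. binary_risk \<phi> (q x i) (g (q x i)) +
           \<kappa> / 2 * (link_inv \<gamma> (score_comp (f x) i) - q x i)\<^sup>2)"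
      by (simp add: cond_risk_def d_def f'_comp sum.distrib sum_distrib_left)
    also have "\<dots> \<le> (\<Sum>i\<in>score_idx s. binary_risk \<phi> (q x i) (score_comp (f x) i) + \<delta>)"
      by (intro sum_mono g_opt q_range)
    also have "\<dots> = cond_risk \<phi> x (f x) + n * \<delta>"
      by (simp add: cond_risk_def sum.distrib n_def)
    finally show ?thesis by (simp add: R_def)
  qed
  have R_nonneg: "0 \<le> R x" for x
  proof -
    have "0 \<le> \<kappa> / 2 * d x" using d_nonneg[of x] \<open>0 < \<kappa>\<close> by simp
    then show ?thesis using d_le[of x] by linarith
  qed
  note int_f = integrable_cond_risk[OF \<phi> f fin]
  \<comment> \<open>Near optimality at every instance dominates the risk of \<open>f'\<close> by
    that of \<open>f\<close> plus a constant.\<close>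
  have int_f': "integrable M (\<lambda>x. cond_risk \<phi> x (f' x))"
  proof (rule Bochner_Integration.integrable_bound)
    show "integrable M (\<lambda>x. cond_risk \<phi> x (f x) + n * \<delta>)" using int_f by simp
    have "norm (cond_risk \<phi> x (f' x)) \<le> norm (cond_risk \<phi> x (f x) + n * \<delta>)" for x
      using R_nonneg[of x] cond_risk_nonneg[OF \<phi>, of x "f' x"] unfolding R_def real_norm_def by linarith
    then show "AE x in M. norm (cond_risk \<phi> x (f' x)) \<le> norm (cond_risk \<phi> x (f x) + n * \<delta>)" by simp
  qed (use cond_risk_measurable[OF \<phi> f'] in simp)
  have fin': "er_surrogate s \<phi> D f' \<noteq> \<infinity>"
    using nn_integral_eq_integral[OF int_f'] cond_risk_nonneg[OF \<phi>] by (simp add: er_surrogate_eq[OF \<phi> f'])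
  have er: "enn2real (er_surrogate s \<phi> D u) = (\<integral>x. cond_risk \<phi> x (u x) \<partial>M)"
    if "u \<in> X \<rightarrow>\<^sub>M score_space s" "er_surrogate s \<phi> D u \<noteq> \<infinity>" for u
    using cond_risk_nonneg[OF \<phi>] by (simp flip: integral_cond_risk[OF \<phi> that])
  define r where "r = enn2real (er_surrogate s \<phi> D f) - enn2real (er_surrogate s \<phi> D f') + \<epsilon>"
  have int_R: "integrable M R" unfolding R_def using int_f int_f' by simp
  have "(\<integral>x. R x \<partial>M) = r - \<epsilon> + n * \<delta>"
    using int_f int_f' M.prob_space by (simp add: R_def r_def er[OF f fin] er[OF f' fin'])
  then have R_r: "(\<integral>x. R x \<partial>M) < r" using \<delta> by simp
  then have "0 < r" using Bochner_Integration.integral_nonneg[of M R] R_nonneg by fastforce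
  define K where "K = (1 + \<beta>\<^sup>2) / \<beta> * sqrt (2 * (ln (real s) + 1) / \<kappa>)"
  have K: "0 \<le> K" using assms by (simp add: K_def)
  have gap: "cond_acc \<beta> x (h' x) - cond_acc \<beta> x (h x) \<le> K * sqrt (R x)" if x: "x \<in> space M" for x
  proof -
    have "cond_acc \<beta> x (h' x) - cond_acc \<beta> x (h x) =
        (\<Sum>i\<in>score_idx s. (coef_B s \<beta> (h x) i - coef_B s \<beta> (h' x) i) * q x i)"
      by (simp add: cond_acc_def sum_subtractf algebra_simps)
    also have "\<dots> \<le> (1 + \<beta>\<^sup>2) / \<beta> * sqrt ((ln (real s) + 1) * d x)"
      unfolding d_def using x h h' opt
      by (intro decode_gap_le \<open>1 \<le> s\<close> \<open>0 < \<beta>\<close>) (auto dest: measurable_space)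
    \<comment> \<open>Strong properness, solved for \<open>d x\<close>, supplies the factor
      \<open>2 / \<kappa>\<close> of \<open>K\<close>.\<close>
    also have "\<dots> \<le> (1 + \<beta>\<^sup>2) / \<beta> * sqrt ((ln (real s) + 1) * (2 / \<kappa> * R x))"
      using d_le[of x] assms by (intro mult_left_mono real_sqrt_le_mono) (auto simp: field_simps)
    also have "\<dots> = K * sqrt (R x)"
      by (simp add: K_def mult_ac flip: real_sqrt_mult)
    finally show ?thesis .
  qed
  have "acc_F s \<beta> D h' - acc_F s \<beta> D h = (\<integral>x. cond_acc \<beta> x (h' x) - cond_acc \<beta> x (h x) \<partial>M)"
    by (simp add: acc_F_eq h h' \<open>0 < \<beta>\<close> cond_acc_integrable)
  also have "\<dots> \<le> K * sqrt r"
    using R_nonneg gap K \<open>0 < r\<close> R_r int_R h h' cond_acc_integrable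
    by (intro M.integral_le_sqrt[where R = R]) auto
  finally show ?thesis using that f' fin' by (simp add: K_def r_def)
qed

text \<open>The slack is removed here: \<rho> bounds all differences of finite risks, hence also the
  one for the \<open>f'\<close> belonging to each \<epsilon>, and the square root is
  subadditive.\<close>

lemma acc_gap_le_regret:
  assumes "1 \<le> s" "0 < \<beta>" "0 < \<kappa>" and \<phi>: "binary_loss \<phi>" and link: "link_function \<gamma>"
    and spc: "strongly_proper_composite \<kappa> \<phi> \<gamma>"
    and f: "f \<in> X \<rightarrow>\<^sub>M score_space s" and fin: "er_surrogate s \<phi> D f \<noteq> \<infinity>"
    and h: "h \<in> X \<rightarrow>\<^sub>M count_space (cube s)" and h': "h' \<in> X \<rightarrow>\<^sub>M count_space (cube s)"
    and opt: "\<And>x. x \<in> space X \<Longrightarrow>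
      decode_objective s \<beta> \<gamma> (f x) (h x) \<le> decode_objective s \<beta> \<gamma> (f x) (h' x)"
    and \<rho>: "0 \<le> \<rho>" "\<And>f'. f' \<in> X \<rightarrow>\<^sub>M score_space s \<Longrightarrow> er_surrogate s \<phi> D f' \<noteq> \<infinity> \<Longrightarrow>
      enn2real (er_surrogate s \<phi> D f) - enn2real (er_surrogate s \<phi> D f') \<le> \<rho>"
  shows "acc_F s \<beta> D h' - acc_F s \<beta> D h \<le>
    (1 + \<beta>\<^sup>2) / \<beta> * sqrt (2 * (ln (real s) + 1) / \<kappa> * \<rho>)"
proof -
  define K where "K = (1 + \<beta>\<^sup>2) / \<beta> * sqrt (2 * (ln (real s) + 1) / \<kappa>)"
  have "0 < ln (real s) + 1" "0 < 1 + \<beta>\<^sup>2"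
    using \<open>1 \<le> s\<close> by (simp_all add: add_nonneg_pos add_pos_nonneg)
  then have K: "0 < K" using \<open>0 < \<beta>\<close> \<open>0 < \<kappa>\<close> by (simp add: K_def)
  have "acc_F s \<beta> D h' - acc_F s \<beta> D h \<le> K * sqrt \<rho> + e" if "0 < e" for e
  proof -
    \<comment> \<open>Chosen so that \<open>K * sqrt \<epsilon>\<close> is exactly
      \<open>e\<close>.\<close>
    define \<epsilon> where "\<epsilon> = (e / K)\<^sup>2"
    have "0 < \<epsilon>" using that K by (simp add: \<epsilon>_def)
    obtain f' where f': "f' \<in> X \<rightarrow>\<^sub>M score_space s" "er_surrogate s \<phi> D f' \<noteq> \<infinity>"
      and gap: "acc_F s \<beta> D h' - acc_F s \<beta> D h \<le>
        K * sqrt (enn2real (er_surrogate s \<phi> D f) - enn2real (er_surrogate s \<phi> D f') + \<epsilon>)"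
      unfolding K_def by (rule acc_gap_le_er_gap[OF assms(1-7) fin h h' opt \<open>0 < \<epsilon>\<close>])
    note gap
    also have "K * sqrt (enn2real (er_surrogate s \<phi> D f) - enn2real (er_surrogate s \<phi> D f') + \<epsilon>)
        \<le> K * sqrt (\<rho> + \<epsilon>)"
      using K \<rho>(2)[OF f'] by (intro mult_left_mono real_sqrt_le_mono) auto
    also have "\<dots> \<le> K * (sqrt \<rho> + sqrt \<epsilon>)"
      using K \<rho>(1) \<open>0 < \<epsilon>\<close> by (intro mult_left_mono sqrt_add_le_add_sqrt) auto
    also have "\<dots> = K * sqrt \<rho> + e"
      using K that by (simp add: \<epsilon>_def algebra_simps)
    finally show ?thesis .
  qed
  then have "acc_F s \<beta> D h' - acc_F s \<beta> D h \<le> K * sqrt \<rho>" by (rule field_le_epsilon)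
  also have "K * sqrt \<rho> = (1 + \<beta>\<^sup>2) / \<beta> * sqrt (2 * (ln (real s) + 1) / \<kappa> * \<rho>)"
    unfolding K_def real_sqrt_mult[of _ \<rho>] by (rule mult.assoc)
  finally show ?thesis .
qed

end

section \<open>From pairwise comparisons to the two regrets\<close>

theorem theorem5:
  fixes s :: nat and \<beta> \<kappa> :: real
    and \<phi> :: "int \<Rightarrow> real \<Rightarrow> real"
    and \<gamma> :: "real \<Rightarrow> ereal"
    and decode :: "score \<Rightarrow> nat \<Rightarrow> nat"
    and X :: "'a measure"
    and D :: "('a \<times> (nat \<Rightarrow> nat)) measure"
    and f :: "'a \<Rightarrow> score"
  assumes "1 \<le> s" and "0 < \<beta>" and "0 < \<kappa>"
    and "binary_loss \<phi>"
    and "link_function \<gamma>"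
    and "strongly_proper_composite \<kappa> \<phi> \<gamma>"
    and "is_decode s \<beta> \<gamma> decode"
    and "prob_space D"
    and "sets D = sets (X \<Otimes>\<^sub>M count_space (cube s))"
    and "f \<in> X \<rightarrow>\<^sub>M score_space s"
  shows "ereal (regret_F X s \<beta> D (decode \<circ> f)) \<le>
         ereal ((1 + \<beta>\<^sup>2) / \<beta>) *
         esqrt (ereal (2 * (ln (real s) + 1) / \<kappa>) * regret_surrogate X s \<phi> D f)"
proof -
  let ?er = "er_surrogate s \<phi> D" and ?H = "X \<rightarrow>\<^sub>M count_space (cube s)"
  have const: "0 < (1 + \<beta>\<^sup>2) / \<beta>" "0 < 2 * (ln (real s) + 1) / \<kappa>"
    using assms(1-3) by (auto intro!: divide_pos_pos add_pos_nonneg mult_pos_pos add_nonneg_pos)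
  show ?thesis
  proof (cases "?er f = \<infinity>")
    \<comment> \<open>Both constants are positive, so the right-hand side is infinite.\<close>
    case True
    have inf: "ereal c * \<infinity> = \<infinity>" if "0 < c" for c :: real using that by simp
    have "regret_surrogate X s \<phi> D f = \<infinity>" using True by (simp add: regret_surrogate_def)
    then have "ereal ((1 + \<beta>\<^sup>2) / \<beta>) *
        esqrt (ereal (2 * (ln (real s) + 1) / \<kappa>) * regret_surrogate X s \<phi> D f) = \<infinity>"
      by (simp only: esqrt_def inf[OF const(1)] inf[OF const(2)] simp_thms if_True)
    then show ?thesis by (simp only: ereal_less_eq)
  next
    case False
    have "\<exists>p. cube_disintegration X s D p"
    proof (rule finite_disintegration[OF assms(8,9) finite_cube])
      fix p
      assume "\<And>y. y \<in> cube s \<Longrightarrow> p y \<in> borel_measurable X" "\<And>y x. 0 \<le> p y x"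
        and "\<And>x. (\<Sum>y\<in>cube s. p y x) = 1"
        and "\<And>g. (\<And>y. y \<in> cube s \<Longrightarrow> (\<lambda>x. g (x, y)) \<in> borel_measurable X) \<Longrightarrow>
          (\<integral>\<^sup>+z. g z \<partial>D) = (\<integral>\<^sup>+x. (\<Sum>y\<in>cube s. ennreal (p y x) * g (x, y)) \<partial>distr D X fst)"
      then have "cube_disintegration X s D p"
        by (intro cube_disintegration.intro assms(8,9)) blast+
      then show ?thesis by blast
    qed
    then obtain p where "cube_disintegration X s D p" ..
    then interpret cube_disintegration X s D p .
    have dec: "decode \<circ> f \<in> ?H"
      using assms(7,10) by (auto simp: is_decode_def intro: measurable_comp)
    have opt: "decode_objective s \<beta> \<gamma> (f x) ((decode \<circ> f) x) \<le> decode_objective s \<beta> \<gamma> (f x) (h' x)"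
      if "h' \<in> ?H" "x \<in> space X" for h' x
      using assms(7) measurable_space[OF assms(10) that(2)] measurable_space[OF that]
      by (auto simp: is_decode_def is_arg_min_linorder)
    define I where "I = (INF f' \<in> X \<rightarrow>\<^sub>M score_space s. ?er f')"
    define \<rho> where "\<rho> = enn2real (?er f) - enn2real I"
    have I_le: "I \<le> ?er f'" if "f' \<in> X \<rightarrow>\<^sub>M score_space s" for f'
      unfolding I_def using that by (rule INF_lower)
    \<comment> \<open>\<open>enn2real\<close> sends infinity to 0, so it preserves this inequality
      only when the risk of \<open>f'\<close> is finite.\<close>
    have I_mono: "enn2real I \<le> enn2real (?er f')"
      if "f' \<in> X \<rightarrow>\<^sub>M score_space s" "?er f' \<noteq> \<infinity>" for f'
      using I_le[OF that(1)] that(2) by (intro enn2real_mono) (auto simp: less_top)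
    have I_fin: "I \<noteq> \<infinity>" using I_le[OF assms(10)] False by (metis neq_top_trans infinity_ennreal_def)
    have regret: "regret_surrogate X s \<phi> D f = ereal \<rho>"
      using False I_fin unfolding regret_surrogate_def I_def[symmetric] \<rho>_def
      by (cases "?er f" rule: ennreal_cases; cases I rule: ennreal_cases)
         (simp_all add: enn2ereal_ennreal)
    have "regret_F X s \<beta> D (decode \<circ> f) \<le> (1 + \<beta>\<^sup>2) / \<beta> * sqrt (2 * (ln (real s) + 1) / \<kappa> * \<rho>)"
    proof -
      have "acc_F s \<beta> D h' \<le> (1 + \<beta>\<^sup>2) / \<beta> * sqrt (2 * (ln (real s) + 1) / \<kappa> * \<rho>)
          + acc_F s \<beta> D (decode \<circ> f)" if "h' \<in> ?H" for h'
      proof -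
        have "acc_F s \<beta> D h' - acc_F s \<beta> D (decode \<circ> f) \<le>
            (1 + \<beta>\<^sup>2) / \<beta> * sqrt (2 * (ln (real s) + 1) / \<kappa> * \<rho>)"
          by (rule acc_gap_le_regret[OF assms(1-6,10) False dec that])
             (use opt[OF that] I_mono assms(10) False in \<open>auto simp: \<rho>_def\<close>)
        then show ?thesis by linarith
      qed
      \<comment> \<open>The bound is the same for every competitor, and the set of competitors is
        nonempty because it contains \<open>decode \<circ> f\<close>.\<close>
      then have "(SUP h' \<in> ?H. acc_F s \<beta> D h') \<le>
          (1 + \<beta>\<^sup>2) / \<beta> * sqrt (2 * (ln (real s) + 1) / \<kappa> * \<rho>) + acc_F s \<beta> D (decode \<circ> f)"
        using dec by (intro cSUP_least) auto
      then show ?thesis by (simp add: regret_F_def)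
    qed
    then show ?thesis by (simp add: regret esqrt_def)
  qed
qed

end
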